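(* Let $\mathcal{A}$ be an $n$-dimensional complex anticommutative algebra of (finite) length $k$. Then there exists an $n$-dimensional nilpotent anticommutative algebra with nilpotency index $k+1$.
   Context: Length: for a finite subset $S$ of an algebra $\mathcal{A}$, a word in $S$ is any product, with any bracketing, of finitely many elements of $S$; its length is the number of factors. $S^i$ is the set of words of length $\le i$, $\mathcal{L}_i(S)$ is the linear span of $S^i$, and $\mathcal{L}(S)=\bigcup_i\mathcal{L}_i(S)$. If $\mathcal{L}(S)=\mathcal{A}$ ($S$ generates $\mathcal{A}$), $l(S)=\min\{i\ge1:\mathcal{L}_i(S)=\mathcal{A}\}$. The length of $\mathcal{A}$ is $l(\mathcal{A})=\sup\{l(S): S\subseteq\mathcal{A}\text{ finite}, \mathcal{L}(S)=\mathcal{A}\}$. Nilpotency: $N^1=N$, $N^{k+1}=\sum_{i=1}^kN^iN^{k+1-i}$; nilpotency index is the least $k$ with $N^k=0$. Anticommutative means $xy=-yx$. *)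

theory Defs
  imports "HOL-Analysis.Analysis"
begin

text \<open>An algebra of dimension n = CARD('n) over the complex numbers is modelled as
  the complex vector space complex^'n together with a complex-bilinear product m.\<close>

type_synonym ('n) cvec = "complex ^ ('n::finite)"

definition cbilinear :: "(('n::finite) cvec \<Rightarrow> ('n::finite) cvec \<Rightarrow> ('n::finite) cvec) \<Rightarrow> bool" where
  "cbilinear m \<longleftrightarrow>
     (\<forall>y. Vector_Spaces.linear (*s) (*s) (\<lambda>x. m x y)) \<and>
     (\<forall>x. Vector_Spaces.linear (*s) (*s) (\<lambda>y. m x y))"

definition anticommutative :: "(('n::finite) cvec \<Rightarrow> ('n::finite) cvec \<Rightarrow> ('n::finite) cvec) \<Rightarrow> bool" where
  "anticommutative m \<longleftrightarrow> (\<forall>x y. m x y = - m y x)"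

text \<open>word m S x l: x is a word in S (any bracketing) with l factors.\<close>
inductive word :: "(('n::finite) cvec \<Rightarrow> ('n::finite) cvec \<Rightarrow> ('n::finite) cvec) \<Rightarrow> ('n::finite) cvec set \<Rightarrow> ('n::finite) cvec \<Rightarrow> nat \<Rightarrow> bool"
  for m S where
  single: "x \<in> S \<Longrightarrow> word m S x 1"
| prod: "word m S x i \<Longrightarrow> word m S y j \<Longrightarrow> word m S (m x y) (i + j)"

definition words_upto :: "(('n::finite) cvec \<Rightarrow> ('n::finite) cvec \<Rightarrow> ('n::finite) cvec) \<Rightarrow> ('n::finite) cvec set \<Rightarrow> nat \<Rightarrow> ('n::finite) cvec set" where
  "words_upto m S i = {x. \<exists>l\<le>i. word m S x l}"

definition Lspan :: "(('n::finite) cvec \<Rightarrow> ('n::finite) cvec \<Rightarrow> ('n::finite) cvec) \<Rightarrow> ('n::finite) cvec set \<Rightarrow> nat \<Rightarrow> ('n::finite) cvec set" where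
  "Lspan m S i = vec.span (words_upto m S i)"

definition generates :: "(('n::finite) cvec \<Rightarrow> ('n::finite) cvec \<Rightarrow> ('n::finite) cvec) \<Rightarrow> ('n::finite) cvec set \<Rightarrow> bool" where
  "generates m S \<longleftrightarrow> (\<Union>i. Lspan m S i) = UNIV"

definition set_length :: "(('n::finite) cvec \<Rightarrow> ('n::finite) cvec \<Rightarrow> ('n::finite) cvec) \<Rightarrow> ('n::finite) cvec set \<Rightarrow> nat" where
  "set_length m S = (LEAST i. 1 \<le> i \<and> Lspan m S i = UNIV)"

text \<open>The length of the algebra is (finite and) equal to k: k is the supremum of the
  lengths of finite generating sets (the supremum is attained, being finite).\<close>
definition has_length :: "(('n::finite) cvec \<Rightarrow> ('n::finite) cvec \<Rightarrow> ('n::finite) cvec) \<Rightarrow> nat \<Rightarrow> bool" where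
  "has_length m k \<longleftrightarrow>
     (\<forall>S. finite S \<and> generates m S \<longrightarrow> set_length m S \<le> k) \<and>
     (\<exists>S. finite S \<and> generates m S \<and> set_length m S = k)"

text \<open>Powers N^1 = N, N^(k+1) = sum_{i=1..k} N^i N^(k+1-i), where the product of
  subspaces is the span of pairwise products and sums of subspaces are spans of unions.\<close>
function pw :: "(('n::finite) cvec \<Rightarrow> ('n::finite) cvec \<Rightarrow> ('n::finite) cvec) \<Rightarrow> nat \<Rightarrow> ('n::finite) cvec set" where
  "pw m 0 = UNIV"
| "pw m (Suc 0) = UNIV"
| "pw m (Suc (Suc k)) =
     vec.span (\<Union>i\<in>{1..Suc k}. {m x y | x y. x \<in> pw m i \<and> y \<in> pw m (Suc (Suc k) - i)})"
  by pat_completeness auto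
termination
  by (relation "Wellfounded.measure (\<lambda>(m, k). k)") auto

definition nilpotent :: "(('n::finite) cvec \<Rightarrow> ('n::finite) cvec \<Rightarrow> ('n::finite) cvec) \<Rightarrow> bool" where
  "nilpotent m \<longleftrightarrow> (\<exists>k\<ge>1. pw m k = {0})"

definition nilpotency_index :: "(('n::finite) cvec \<Rightarrow> ('n::finite) cvec \<Rightarrow> ('n::finite) cvec) \<Rightarrow> nat" where
  "nilpotency_index m = (LEAST k. 1 \<le> k \<and> pw m k = {0})"

end

theory Submission
  imports Defs
begin

text \<open>
  If a finite generating set S realises the length k, the subspaces V l spanned by the words
  of length at most l form a multiplicative filtration 0 = V 0 \<subseteq> V 1 \<subseteq> \<dots> \<subseteq> V k, with
  V (k - 1) a proper subspace. Choosing a basis adapted to this filtration identifies the space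
  with the associated graded algebra, whose product keeps only the component of degree i + j of
  a product of basis vectors of degrees i and j. This product is again bilinear and
  anticommutative, and it raises the degree by at least one per factor, so all products of k + 1
  elements vanish. On the other hand, the top component of a word of length k lying outside
  V (k - 1) is a nonzero product of k elements in the graded algebra, so the nilpotency index
  is exactly k + 1.
\<close>

lemma linear_vecI:
  assumes "\<And>x y. f (x + y) = f x + f y" and "\<And>a x. f (a *s x) = a *s f x"
  shows "Vector_Spaces.linear (*s) (*s) (f :: complex^'n \<Rightarrow> complex^'n)"
  using assms by (simp add: Vector_Spaces.linear_iff vec.vector_space_axioms)

lemma cbilinear_linear_left: "cbilinear m \<Longrightarrow> Vector_Spaces.linear (*s) (*s) (\<lambda>x. m x y)"
  by (simp add: cbilinear_def)

lemma cbilinear_linear_right: "cbilinear m \<Longrightarrow> Vector_Spaces.linear (*s) (*s) (\<lambda>y. m x y)"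
  by (simp add: cbilinear_def)

lemma cbilinear_span_mult_in_subspace:
  assumes "cbilinear m" and "x \<in> vec.span A" and "y \<in> vec.span C" and "vec.subspace T"
    and "\<And>a c. a \<in> A \<Longrightarrow> c \<in> C \<Longrightarrow> m a c \<in> T"
  shows "m x y \<in> T"
proof -
  note vimage = vec.linear_subspace_vimage[OF _ assms(4), unfolded vimage_def]
  have "m x c \<in> T" if "c \<in> C" for c
    using vec.span_induct[OF assms(2) vimage[OF cbilinear_linear_left[OF assms(1)]], of c] assms(5) that
    by auto
  then show ?thesis
    using vec.span_induct[OF assms(3) vimage[OF cbilinear_linear_right[OF assms(1)]], of x]
    by auto
qed

subsection \<open>Words and the length filtration\<close>

lemma word_length_ge_1: "word m S x l \<Longrightarrow> 1 \<le> l"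
  by (induction rule: word.induct) auto

lemma Lspan_0: "Lspan m S 0 = {0}"
proof -
  have "words_upto m S 0 = {}"
    by (auto simp: words_upto_def dest: word_length_ge_1)
  then show ?thesis
    by (simp add: Lspan_def vec.span_empty)
qed

lemma Lspan_mono: "i \<le> j \<Longrightarrow> Lspan m S i \<subseteq> Lspan m S j"
  unfolding Lspan_def by (rule vec.span_mono) (auto simp: words_upto_def intro: le_trans)

lemma subspace_Lspan: "vec.subspace (Lspan m S i)"
  unfolding Lspan_def by (rule vec.subspace_span)

lemma word_in_Lspan: "word m S x l \<Longrightarrow> x \<in> Lspan m S l"
  unfolding Lspan_def words_upto_def by (rule vec.span_base) auto

lemma Lspan_mult:
  assumes "cbilinear m" and "x \<in> Lspan m S i" and "y \<in> Lspan m S j"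
  shows "m x y \<in> Lspan m S (i + j)"
  using assms(1) assms(2,3)[unfolded Lspan_def] subspace_Lspan
proof (rule cbilinear_span_mult_in_subspace)
  fix u v
  assume "u \<in> words_upto m S i" and "v \<in> words_upto m S j"
  then obtain i' j' where "i' \<le> i" "word m S u i'" "j' \<le> j" "word m S v j'"
    by (auto simp: words_upto_def)
  then show "m u v \<in> Lspan m S (i + j)"
    using Lspan_mono[of "i' + j'" "i + j"] word_in_Lspan[OF word.prod]
    by (metis add_mono subsetD)
qed

lemma generates_imp_Lspan_eq_UNIV:
  fixes m :: "complex^'n \<Rightarrow> complex^'n \<Rightarrow> complex^'n"
  assumes "generates m S"
  shows "\<exists>i. Lspan m S i = UNIV"
proof -
  obtain f where f: "\<And>b::complex^'n. b \<in> cart_basis \<Longrightarrow> b \<in> Lspan m S (f b)"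
    using assms by (metis UNIV_I UN_E generates_def)
  let ?i = "\<Sum>b\<in>cart_basis. f b"
  have "cart_basis \<subseteq> Lspan m S ?i"
  proof
    fix b :: "complex^'n"
    assume b: "b \<in> cart_basis"
    have "f b \<le> ?i"
      by (rule member_le_sum) (auto simp: b finite_cart_basis)
    then show "b \<in> Lspan m S ?i"
      using f[OF b] Lspan_mono by blast
  qed
  then have "vec.span cart_basis \<subseteq> Lspan m S ?i"
    by (rule vec.span_minimal[OF _ subspace_Lspan])
  then show ?thesis
    by auto
qed

lemma set_length_generating:
  fixes m :: "complex^'n \<Rightarrow> complex^'n \<Rightarrow> complex^'n"
  assumes "generates m S" and "set_length m S = k"
  shows "1 \<le> k" and "Lspan m S k = UNIV" and "Lspan m S (k - 1) \<noteq> UNIV"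
proof -
  let ?full = "\<lambda>i. 1 \<le> i \<and> Lspan m S i = UNIV"
  obtain i where "Lspan m S i = UNIV"
    using generates_imp_Lspan_eq_UNIV[OF assms(1)] by blast
  then have "?full (max 1 i)"
    using Lspan_mono[of i "max 1 i" m S] by auto
  then have "?full k"
    using assms(2) unfolding set_length_def by (metis (mono_tags, lifting) LeastI)
  then show "1 \<le> k" and "Lspan m S k = UNIV"
    by auto
  have "(\<chi> i. 1) \<notin> Lspan m S 0"
    by (simp add: Lspan_0 vec_eq_iff)
  moreover have "\<not> ?full (k - 1)" if "k \<noteq> 1"
    using not_less_Least[of "k - 1" ?full] assms(2) that \<open>1 \<le> k\<close>
    by (simp add: set_length_def)
  ultimately show "Lspan m S (k - 1) \<noteq> UNIV"
    using \<open>1 \<le> k\<close> by (cases "k = 1") auto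
qed

lemma ex_word_not_in_Lspan_pred:
  assumes "Lspan m S (l - 1) \<noteq> Lspan m S l"
  shows "\<exists>w. word m S w l \<and> w \<notin> Lspan m S (l - 1)"
proof (rule ccontr)
  assume no_word: "\<not> ?thesis"
  have "words_upto m S l \<subseteq> Lspan m S (l - 1)"
  proof
    fix w
    assume "w \<in> words_upto m S l"
    then obtain l' where "l' \<le> l" and w: "word m S w l'"
      by (auto simp: words_upto_def)
    show "w \<in> Lspan m S (l - 1)"
    proof (cases "l' = l")
      case False
      then show ?thesis
        using \<open>l' \<le> l\<close> word_in_Lspan[OF w] Lspan_mono[of l' "l - 1" m S] by fastforce
    qed (use w no_word in blast)
  qed
  then have "Lspan m S l \<subseteq> Lspan m S (l - 1)"
    unfolding Lspan_def[of m S l] by (rule vec.span_minimal[OF _ subspace_Lspan])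
  moreover have "Lspan m S (l - 1) \<subseteq> Lspan m S l"
    by (rule Lspan_mono) simp
  ultimately show False
    using assms by blast
qed

subsection \<open>Powers of an algebra\<close>

lemma subspace_pw: "vec.subspace (pw m l)"
proof (cases l)
  case (Suc l')
  then show ?thesis
    by (cases l') (auto intro: vec.subspace_span)
qed simp

lemma zero_in_pw: "0 \<in> pw m l"
  using subspace_pw vec.subspace_0 by blast

lemma mult_in_pw:
  assumes "1 \<le> i" and "1 \<le> j" and "x \<in> pw m i" and "y \<in> pw m j"
  shows "m x y \<in> pw m (i + j)"
proof -
  obtain l where l: "i + j = Suc (Suc l)"
    using assms(1,2) by (metis add_le_mono le_Suc_ex one_add_one add_2_eq_Suc)
  have "j = Suc (Suc l) - i"
    using l by simp
  then have "m x y \<in> (\<Union>i'\<in>{1..Suc l}. {m x y | x y. x \<in> pw m i' \<and> y \<in> pw m (Suc (Suc l) - i')})"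
    using assms l by (intro UN_I[of i]) auto
  then show ?thesis
    unfolding l pw.simps(3) by (rule vec.span_base)
qed

lemma pw_subset_of_mult_subset:
  assumes "2 \<le> l" and "vec.subspace T"
    and "\<And>i j x y. 1 \<le> i \<Longrightarrow> 1 \<le> j \<Longrightarrow> i + j = l \<Longrightarrow> x \<in> pw m i \<Longrightarrow> y \<in> pw m j \<Longrightarrow>
      m x y \<in> T"
  shows "pw m l \<subseteq> T"
proof -
  obtain l' where l': "l = Suc (Suc l')"
    using assms(1) by (metis add_2_eq_Suc le_Suc_ex)
  show ?thesis
    unfolding l' pw.simps(3)
  proof (rule vec.span_minimal[OF _ assms(2)], safe)
    fix i x y
    assume "i \<in> {1..Suc l'}" and "x \<in> pw m i" and "y \<in> pw m (Suc (Suc l') - i)"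
    then show "m x y \<in> T"
      by (intro assms(3)[of i "Suc (Suc l') - i"]) (auto simp: l')
  qed
qed

lemma pw_Suc_subset: "pw m (Suc n) \<subseteq> pw m n"
proof (induction n rule: less_induct)
  case (less n)
  show ?case
  proof (cases "n \<le> 1")
    case True
    then show ?thesis
      by (cases n) auto
  next
    case False
    show ?thesis
    proof (rule pw_subset_of_mult_subset[OF _ subspace_pw])
      fix i j x y
      assume i: "1 \<le> i" and j: "1 \<le> j" and ij: "i + j = Suc n"
        and x: "x \<in> pw m i" and y: "y \<in> pw m j"
      show "m x y \<in> pw m n"
      proof (cases "j = 1")
        case True
        then have "x \<in> pw m (n - 1)"
          using x ij less.IH[of "n - 1"] False by auto
        then show ?thesis
          using mult_in_pw[of "n - 1" 1 x m y] y True False by simp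
      next
        case False
        have "j - 1 < n" and "Suc (j - 1) = j"
          using i j ij by auto
        then have "y \<in> pw m (j - 1)"
          using y less.IH[of "j - 1"] by auto
        then show ?thesis
          using mult_in_pw[of i "j - 1" x m y] x i j ij False by simp
      qed
    qed (use False in simp)
  qed
qed

lemma pw_antimono: "i \<le> j \<Longrightarrow> pw m j \<subseteq> pw m i"
  by (induction j rule: dec_induct) (use pw_Suc_subset in blast)+

lemma word_in_pw: "word m S w l \<Longrightarrow> w \<in> pw m l"
proof (induction rule: word.induct)
  case (prod x i y j)
  then show ?case
    using mult_in_pw word_length_ge_1 by blast
qed simp

lemma pw_subset_multiplicative_filtration:
  assumes "1 \<le> l" and "\<And>l. vec.subspace (G l)" and "G 1 = UNIV"
    and "\<And>i j x y. x \<in> G i \<Longrightarrow> y \<in> G j \<Longrightarrow> m x y \<in> G (i + j)"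
  shows "pw m l \<subseteq> G l"
  using assms(1)
proof (induction l rule: less_induct)
  case (less l)
  show ?case
  proof (cases "l = 1")
    case False
    show ?thesis
    proof (rule pw_subset_of_mult_subset[OF _ assms(2)])
      fix i j x y
      assume "1 \<le> i" "1 \<le> j" "i + j = l" "x \<in> pw m i" "y \<in> pw m j"
      then show "m x y \<in> G l"
        using less.IH[of i] less.IH[of j] assms(4)[of x i y j] by auto
    qed (use less.prems False in simp)
  qed (use assms(3) in simp)
qed

lemma nilpotency_index_eqI:
  assumes "pw m (Suc k) = {0}" and "pw m k \<noteq> {0}"
  shows "nilpotent m \<and> nilpotency_index m = Suc k"
proof
  show "nilpotent m"
    unfolding nilpotent_def using assms(1) by (intro exI[of _ "Suc k"]) simp
  have "Suc k \<le> j" if "pw m j = {0}" for j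
  proof (rule ccontr)
    assume "\<not> Suc k \<le> j"
    then have "pw m k \<subseteq> pw m j"
      by (intro pw_antimono) simp
    then show False
      using assms(2) zero_in_pw[of m k] that by blast
  qed
  then show "nilpotency_index m = Suc k"
    unfolding nilpotency_index_def
    by (intro Least_equality) (simp_all add: assms(1))
qed

subsection \<open>Bases adapted to a filtration\<close>

lemma ex_basis_adapted_to_chain:
  fixes V :: "nat \<Rightarrow> (complex^'n) set"
  assumes "mono V"
  shows "\<exists>B. vec.independent B \<and> B \<subseteq> V l \<and> (\<forall>l'\<le>l. V l' \<subseteq> vec.span {b\<in>B. b \<in> V l'})"
proof (induction l)
  case 0
  obtain B where "B \<subseteq> V 0" "vec.independent B" "V 0 \<subseteq> vec.span B"
    by (rule vec.maximal_independent_subset)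
  then have "{b\<in>B. b \<in> V 0} = B"
    by blast
  with \<open>B \<subseteq> V 0\<close> \<open>vec.independent B\<close> \<open>V 0 \<subseteq> vec.span B\<close> show ?case
    by (intro exI[of _ B]) auto
next
  case (Suc l)
  then obtain B where B: "vec.independent B" "B \<subseteq> V l"
    and adapted: "\<forall>l'\<le>l. V l' \<subseteq> vec.span {b\<in>B. b \<in> V l'}"
    by blast
  have "B \<subseteq> V (Suc l)"
    using B(2) monoD[OF assms, of l "Suc l"] by auto
  then obtain B' where B': "B \<subseteq> B'" "B' \<subseteq> V (Suc l)" "vec.independent B'" "V (Suc l) \<subseteq> vec.span B'"
    using vec.maximal_independent_subset_extend B(1) by metis
  have "V l' \<subseteq> vec.span {b\<in>B'. b \<in> V l'}" if "l' \<le> Suc l" for l'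
  proof (cases "l' \<le> l")
    case True
    have "vec.span {b\<in>B. b \<in> V l'} \<subseteq> vec.span {b\<in>B'. b \<in> V l'}"
      by (rule vec.span_mono) (use B'(1) in auto)
    then show ?thesis
      using adapted True by blast
  next
    case False
    then have "l' = Suc l"
      using that by simp
    then have "{b\<in>B'. b \<in> V l'} = B'"
      using B'(2) by auto
    then show ?thesis
      using B'(4) \<open>l' = Suc l\<close> by simp
  qed
  then show ?case
    using B' by blast
qed

lemma ex_graded_basis_of_filtration:
  fixes V :: "nat \<Rightarrow> (complex^'n) set"
  assumes "mono V" and "\<And>l. vec.subspace (V l)" and "V 0 = {0}" and "V k = UNIV"
  shows "\<exists>B d. vec.independent B \<and> vec.span B = UNIV \<and>
    (\<forall>l. V l = vec.span {b\<in>B. d b \<le> l}) \<and> (\<forall>b\<in>B. 1 \<le> d b \<and> d b \<le> k)"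
proof -
  obtain B where B: "vec.independent B"
    and adapted: "\<forall>l\<le>k. V l \<subseteq> vec.span {b\<in>B. b \<in> V l}"
    using ex_basis_adapted_to_chain[OF assms(1), of k] by blast
  define d where "d b = (LEAST l. b \<in> V l)" for b
  have in_V_iff: "b \<in> V l \<longleftrightarrow> d b \<le> l" for b l
  proof -
    have "b \<in> V (d b)"
      unfolding d_def by (rule LeastI[of _ k]) (simp add: assms(4))
    then show ?thesis
      using monoD[OF assms(1)] Least_le[of "\<lambda>l. b \<in> V l" l] by (auto simp: d_def)
  qed
  have "V k \<subseteq> vec.span B"
    using adapted vec.span_mono[of "{b\<in>B. b \<in> V k}" B] by blast
  then have span_B: "vec.span B = UNIV"
    using assms(4) by blast
  have degree_bounds: "1 \<le> d b \<and> d b \<le> k" if "b \<in> B" for b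
  proof -
    have "b \<noteq> 0"
      using B that vec.dependent_zero by blast
    then show ?thesis
      using in_V_iff[of b 0] in_V_iff[of b k] assms(3,4) by auto
  qed
  have "V l = vec.span {b\<in>B. d b \<le> l}" for l
  proof
    show "vec.span {b\<in>B. d b \<le> l} \<subseteq> V l"
      by (rule vec.span_minimal[OF _ assms(2)]) (auto simp: in_V_iff)
    show "V l \<subseteq> vec.span {b\<in>B. d b \<le> l}"
    proof (cases "l \<le> k")
      case True
      then show ?thesis
        using adapted by (simp add: in_V_iff)
    next
      case False
      then have "{b\<in>B. d b \<le> l} = B"
        using degree_bounds by force
      then show ?thesis
        by (simp add: span_B)
    qed
  qed
  then show ?thesis
    using B span_B degree_bounds by blast
qed

subsection \<open>The associated graded algebra\<close>

locale graded_basis =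
  fixes m :: "complex^'n \<Rightarrow> complex^'n \<Rightarrow> complex^'n"
    and B :: "(complex^'n) set"
    and d :: "complex^'n \<Rightarrow> nat"
  assumes cbilinear: "cbilinear m"
    and independent: "vec.independent B"
    and spanning: "vec.span B = UNIV"
begin

abbreviation coord :: "complex^'n \<Rightarrow> complex^'n \<Rightarrow> complex" where
  "coord x \<equiv> vec.representation B x"

definition span_deg_le :: "nat \<Rightarrow> (complex^'n) set" where
  "span_deg_le l = vec.span {b\<in>B. d b \<le> l}"

definition span_deg_ge :: "nat \<Rightarrow> (complex^'n) set" where
  "span_deg_ge l = vec.span {b\<in>B. l \<le> d b}"

definition component :: "nat \<Rightarrow> complex^'n \<Rightarrow> complex^'n" where
  "component l x = (\<Sum>b\<in>B. (if d b = l then coord x b else 0) *s b)"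

text \<open>
  With span_deg_le as filtration, graded_mult is the product of the associated graded algebra
  transported along the linear isomorphism given by the basis B.
\<close>

definition graded_mult :: "complex^'n \<Rightarrow> complex^'n \<Rightarrow> complex^'n" where
  "graded_mult x y = (\<Sum>p\<in>B. \<Sum>q\<in>B. (coord x p * coord y q) *s component (d p + d q) (m p q))"

lemma finite_basis: "finite B"
  using independent by (rule vec.finiteI_independent)

lemma sum_coord: "(\<Sum>b\<in>B. coord x b *s b) = x"
  by (rule vec.sum_representation_eq) (auto simp: independent spanning finite_basis)

lemma coord_add: "coord (x + y) b = coord x b + coord y b"
  by (simp add: vec.representation_add independent spanning)

lemma coord_scale: "coord (a *s x) b = a * coord x b"
  by (simp add: vec.representation_scale independent spanning)

lemma coord_diff: "coord (x - y) b = coord x b - coord y b"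
  by (simp add: vec.representation_diff independent spanning)

lemma coord_notin_basis: "b \<notin> B \<Longrightarrow> coord x b = 0"
  using vec.representation_ne_zero by blast

lemma coord_lincomb: "b \<in> B \<Longrightarrow> coord (\<Sum>p\<in>B. g p *s p) b = g b"
proof -
  assume b: "b \<in> B"
  have "coord (\<Sum>p\<in>B. g p *s p) b = (\<Sum>p\<in>B. g p * coord p b)"
    by (simp add: vec.representation_sum independent spanning coord_scale)
  also have "\<dots> = (\<Sum>p\<in>B. if p = b then g b else 0)"
    by (rule sum.cong) (auto simp: vec.representation_basis independent)
  also have "\<dots> = g b"
    using b finite_basis by simp
  finally show ?thesis .
qed

lemma in_span_basis_subset_iff: "x \<in> vec.span {b\<in>B. Q b} \<longleftrightarrow> (\<forall>b\<in>B. \<not> Q b \<longrightarrow> coord x b = 0)"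
proof
  assume "x \<in> vec.span {b\<in>B. Q b}"
  then show "\<forall>b\<in>B. \<not> Q b \<longrightarrow> coord x b = 0"
    using vec.representation_extend[OF independent] vec.representation_ne_zero
    by (metis (no_types, lifting) mem_Collect_eq subsetI)
next
  assume zero: "\<forall>b\<in>B. \<not> Q b \<longrightarrow> coord x b = 0"
  have "(\<Sum>b\<in>B. coord x b *s b) \<in> vec.span {b\<in>B. Q b}"
  proof (rule vec.span_sum)
    fix b
    assume "b \<in> B"
    then show "coord x b *s b \<in> vec.span {b\<in>B. Q b}"
      using zero by (cases "Q b") (auto intro: vec.span_scale vec.span_base simp: vec.span_zero)
  qed
  then show "x \<in> vec.span {b\<in>B. Q b}"
    by (simp add: sum_coord)
qed

lemma subspace_span_deg_le: "vec.subspace (span_deg_le l)"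
  unfolding span_deg_le_def by (rule vec.subspace_span)

lemma subspace_span_deg_ge: "vec.subspace (span_deg_ge l)"
  unfolding span_deg_ge_def by (rule vec.subspace_span)

lemma coord_component: "coord (component l x) b = (if d b = l then coord x b else 0)"
  by (cases "b \<in> B") (auto simp: component_def coord_lincomb coord_notin_basis)

lemma linear_component: "Vector_Spaces.linear (*s) (*s) (component l)"
proof (rule linear_vecI)
  show "component l (x + y) = component l x + component l y" for x y
    unfolding component_def sum.distrib[symmetric]
    by (rule sum.cong) (auto simp: coord_add vec.scale_left_distrib)
  show "component l (a *s x) = a *s component l x" for a x
    unfolding component_def vec.scale_sum_right
    by (rule sum.cong) (auto simp: coord_scale)
qed

lemma component_in_span_deg_le: "component l x \<in> span_deg_le l"
  unfolding span_deg_le_def in_span_basis_subset_iff by (simp add: coord_component)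

lemma component_in_span_deg_ge: "l \<le> e \<Longrightarrow> component e x \<in> span_deg_ge l"
  unfolding span_deg_ge_def in_span_basis_subset_iff by (simp add: coord_component)

lemma diff_component_in_span_deg_le:
  "x \<in> span_deg_le l \<Longrightarrow> x - component l x \<in> span_deg_le (l - 1)"
  unfolding span_deg_le_def in_span_basis_subset_iff by (auto simp: coord_diff coord_component)

lemma component_eq_0: "x \<in> span_deg_le j \<Longrightarrow> j < l \<Longrightarrow> component l x = 0"
  unfolding span_deg_le_def in_span_basis_subset_iff component_def
  by (rule sum.neutral) auto

lemma mult_expansion: "m x y = (\<Sum>p\<in>B. \<Sum>q\<in>B. (coord x p * coord y q) *s m p q)"
proof -
  note left = cbilinear_linear_left[OF cbilinear] and right = cbilinear_linear_right[OF cbilinear]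
  have "m x y = m (\<Sum>p\<in>B. coord x p *s p) (\<Sum>q\<in>B. coord y q *s q)"
    by (simp add: sum_coord)
  also have "\<dots> = (\<Sum>p\<in>B. coord x p *s m p (\<Sum>q\<in>B. coord y q *s q))"
    by (simp only: vec.linear_sum[OF left] vec.linear_scale[OF left])
  also have "\<dots> = (\<Sum>p\<in>B. \<Sum>q\<in>B. (coord x p * coord y q) *s m p q)"
    by (simp only: vec.linear_sum[OF right] vec.linear_scale[OF right] vec.scale_sum_right
        vec.scale_scale)
  finally show ?thesis .
qed

lemma cbilinear_graded_mult: "cbilinear graded_mult"
  unfolding cbilinear_def
proof (intro conjI allI)
  fix y
  show "Vector_Spaces.linear (*s) (*s) (\<lambda>x. graded_mult x y)"
  proof (rule linear_vecI)
    show "graded_mult (x1 + x2) y = graded_mult x1 y + graded_mult x2 y" for x1 x2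
      unfolding graded_mult_def sum.distrib[symmetric]
      by (intro sum.cong refl) (simp add: coord_add distrib_right vec.scale_left_distrib)
    show "graded_mult (a *s x) y = a *s graded_mult x y" for a x
      unfolding graded_mult_def by (simp add: coord_scale vec.scale_sum_right mult.assoc)
  qed
next
  fix x
  show "Vector_Spaces.linear (*s) (*s) (\<lambda>y. graded_mult x y)"
  proof (rule linear_vecI)
    show "graded_mult x (y1 + y2) = graded_mult x y1 + graded_mult x y2" for y1 y2
      unfolding graded_mult_def sum.distrib[symmetric]
      by (intro sum.cong refl) (simp add: coord_add distrib_left vec.scale_left_distrib)
    show "graded_mult x (a *s y) = a *s graded_mult x y" for a y
      unfolding graded_mult_def
      by (simp add: coord_scale vec.scale_sum_right mult.assoc mult.left_commute)
  qed
qed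

lemma anticommutative_graded_mult:
  assumes "anticommutative m"
  shows "anticommutative graded_mult"
  unfolding anticommutative_def
proof (intro allI)
  fix x y
  have "graded_mult y x = (\<Sum>q\<in>B. \<Sum>p\<in>B. (coord y p * coord x q) *s component (d p + d q) (m p q))"
    unfolding graded_mult_def by (rule sum.swap)
  also have "\<dots> = (\<Sum>q\<in>B. \<Sum>p\<in>B. - ((coord x q * coord y p) *s component (d q + d p) (m q p)))"
  proof (intro sum.cong refl)
    fix p q
    have "m p q = - m q p"
      using assms unfolding anticommutative_def by blast
    then show "(coord y p * coord x q) *s component (d p + d q) (m p q) =
        - ((coord x q * coord y p) *s component (d q + d p) (m q p))"
      by (simp add: vec.linear_neg[OF linear_component] ac_simps)
  qed
  also have "\<dots> = - graded_mult x y"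
    unfolding graded_mult_def by (simp add: sum_negf)
  finally show "graded_mult x y = - graded_mult y x"
    by simp
qed

lemma graded_mult_components:
  "graded_mult (component i x) (component j y) = component (i + j) (m (component i x) (component j y))"
proof -
  let ?x = "component i x" and ?y = "component j y"
  have "component (i + j) (m ?x ?y) =
      (\<Sum>p\<in>B. \<Sum>q\<in>B. (coord ?x p * coord ?y q) *s component (i + j) (m p q))"
    by (subst mult_expansion)
      (simp add: vec.linear_sum[OF linear_component] vec.linear_scale[OF linear_component])
  also have "\<dots> = graded_mult ?x ?y"
    unfolding graded_mult_def by (intro sum.cong refl) (simp add: coord_component)
  finally show ?thesis ..
qed

lemma graded_mult_span_deg_ge:
  assumes "x \<in> span_deg_ge i" and "y \<in> span_deg_ge j"
  shows "graded_mult x y \<in> span_deg_ge (i + j)"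
  unfolding graded_mult_def
proof (intro vec.span_sum[of _ _ "{b\<in>B. i + j \<le> d b}", folded span_deg_ge_def])
  fix p q
  assume "p \<in> B" and "q \<in> B"
  show "(coord x p * coord y q) *s component (d p + d q) (m p q) \<in> span_deg_ge (i + j)"
  proof (cases "coord x p = 0 \<or> coord y q = 0")
    case False
    then have "i \<le> d p" and "j \<le> d q"
      using assms \<open>p \<in> B\<close> \<open>q \<in> B\<close> unfolding span_deg_ge_def in_span_basis_subset_iff
      by force+
    then show ?thesis
      unfolding span_deg_ge_def
      by (intro vec.span_scale component_in_span_deg_ge[unfolded span_deg_ge_def]) simp
  qed (auto simp: span_deg_ge_def vec.span_zero)
qed

context
  fixes S :: "(complex^'n) set"
  assumes generators_deg_le_1: "S \<subseteq> span_deg_le 1"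
    and mult_span_deg_le: "\<And>i j x y. x \<in> span_deg_le i \<Longrightarrow> y \<in> span_deg_le j \<Longrightarrow>
      m x y \<in> span_deg_le (i + j)"
begin

lemma word_in_span_deg_le: "word m S w l \<Longrightarrow> w \<in> span_deg_le l"
  by (induction rule: word.induct) (use generators_deg_le_1 mult_span_deg_le in auto)

lemma word_component: "word m S w l \<Longrightarrow> word graded_mult (component 1 ` S) (component l w) l"
proof (induction rule: word.induct)
  case (single x)
  then show ?case
    by (intro word.single) auto
next
  case (prod x i y j)
  note left = cbilinear_linear_left[OF cbilinear] and right = cbilinear_linear_right[OF cbilinear]
  have "1 \<le> i" and "1 \<le> j"
    using prod.hyps word_length_ge_1 by blast+
  have x: "x - component i x \<in> span_deg_le (i - 1)"
    using diff_component_in_span_deg_le[OF word_in_span_deg_le[OF prod.hyps(1)]] .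
  have y: "y - component j y \<in> span_deg_le (j - 1)"
    using diff_component_in_span_deg_le[OF word_in_span_deg_le[OF prod.hyps(2)]] .
  have "m x y - m (component i x) (component j y) =
      m (x - component i x) y + m (component i x) (y - component j y)"
    by (simp add: vec.linear_diff[OF left] vec.linear_diff[OF right])
  also have "\<dots> \<in> span_deg_le (i + j - 1)"
    using mult_span_deg_le[OF x word_in_span_deg_le[OF prod.hyps(2)]]
      mult_span_deg_le[OF component_in_span_deg_le y] \<open>1 \<le> i\<close> \<open>1 \<le> j\<close>
    by (intro vec.subspace_add[OF subspace_span_deg_le]) (simp_all add: add.commute)
  finally have "component (i + j) (m x y - m (component i x) (component j y)) = 0"
    by (rule component_eq_0) (use \<open>1 \<le> i\<close> in simp)
  then have "component (i + j) (m x y) = component (i + j) (m (component i x) (component j y))"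
    by (simp add: vec.linear_diff[OF linear_component])
  then show ?case
    using word.prod[OF prod.IH] by (simp add: graded_mult_components)
qed

lemma nilpotency_index_graded_mult:
  assumes degrees: "\<forall>b\<in>B. 1 \<le> d b \<and> d b \<le> k"
    and w: "word m S w k" and w_new: "w \<notin> span_deg_le (k - 1)"
  shows "nilpotent graded_mult \<and> nilpotency_index graded_mult = Suc k"
proof (rule nilpotency_index_eqI)
  have "{b\<in>B. 1 \<le> d b} = B"
    using degrees by blast
  then have "span_deg_ge 1 = UNIV"
    unfolding span_deg_ge_def by (simp add: spanning)
  then have "pw graded_mult (Suc k) \<subseteq> span_deg_ge (Suc k)"
    using graded_mult_span_deg_ge subspace_span_deg_ge
    by (intro pw_subset_multiplicative_filtration) auto
  also have "{b\<in>B. Suc k \<le> d b} = {}"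
    using degrees by force
  then have "span_deg_ge (Suc k) = {0}"
    unfolding span_deg_ge_def by (simp only: vec.span_empty)
  finally show "pw graded_mult (Suc k) = {0}"
    using zero_in_pw by blast
  have "w - component k w \<in> span_deg_le (k - 1)"
    using w by (intro diff_component_in_span_deg_le word_in_span_deg_le)
  then have "component k w \<noteq> 0"
    using w_new by auto
  moreover have "component k w \<in> pw graded_mult k"
    using word_in_pw[OF word_component[OF w]] .
  ultimately show "pw graded_mult k \<noteq> {0}"
    by blast
qed

end

end

theorem mainTheorem5:
  fixes m :: "complex ^ 'n \<Rightarrow> complex ^ 'n \<Rightarrow> complex ^ 'n" and k :: nat
  assumes "cbilinear m" and "anticommutative m" and "has_length m k"
  shows "\<exists>m' :: complex ^ 'n \<Rightarrow> complex ^ 'n \<Rightarrow> complex ^ 'n.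
           cbilinear m' \<and> anticommutative m' \<and> nilpotent m' \<and> nilpotency_index m' = k + 1"
proof -
  obtain S where "generates m S" and "set_length m S = k"
    using assms(3) unfolding has_length_def by blast
  note length = set_length_generating[OF this]
  obtain w where w: "word m S w k" "w \<notin> Lspan m S (k - 1)"
    using ex_word_not_in_Lspan_pred[of m S k] length(2,3) by auto
  obtain B d where B: "vec.independent B" "vec.span B = UNIV"
    and filtration: "\<forall>l. Lspan m S l = vec.span {b\<in>B. d b \<le> l}"
    and degrees: "\<forall>b\<in>B. 1 \<le> d b \<and> d b \<le> k"
    using ex_graded_basis_of_filtration[OF monoI[OF Lspan_mono] subspace_Lspan Lspan_0 length(2)]
    by blast
  interpret graded_basis m B d
    using assms(1) B by unfold_locales
  have Lspan_eq: "Lspan m S = span_deg_le"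
    using filtration by (intro ext) (simp add: span_deg_le_def)
  have generators: "S \<subseteq> span_deg_le 1"
    using word_in_Lspan[OF word.single, of _ S m] by (auto simp: Lspan_eq)
  have mult: "\<And>i j x y. x \<in> span_deg_le i \<Longrightarrow> y \<in> span_deg_le j \<Longrightarrow> m x y \<in> span_deg_le (i + j)"
    using Lspan_mult[OF assms(1), of _ S] by (simp add: Lspan_eq)
  have "nilpotent graded_mult \<and> nilpotency_index graded_mult = Suc k"
    using nilpotency_index_graded_mult[OF generators mult degrees w(1)] w(2)
    unfolding Lspan_eq by blast
  then show ?thesis
    by (intro exI[of _ graded_mult])
      (simp add: cbilinear_graded_mult anticommutative_graded_mult assms(2))
qed

end
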